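(* Let $I$ be a non-empty singular support of full resonance rank, that is, $\dim Q_I=n-k$. Then $r_I=|I|$ and $$M_I\otimes_{\mathbb Z}\mathbb C=\ker\bigl(\mu_I:\mathbb C^J\to\mathfrak h_I^*\bigr).$$ In particular the support weights $\Lambda_i$, $i\in I$, are linearly independent. Moreover the coordinate-labelled envelope and the logarithmic connection $\nabla_I$, with labelled support coordinates, determine the ambient weight configuration $(\Lambda_1,\dots,\Lambda_n)$ up to linear equivalence: if $(\Lambda_1,\dots,\Lambda_n)$ and $(\Lambda_1',\dots,\Lambda_n')$ are two spanning configurations in $(\mathbb C^k)^*$ for both of which $I$ is a singular support of full resonance rank, with the same semigroup $S_I=S_I'\subset\mathbb N^J$ and the same logarithmic connection $\nabla_I=\nabla_I'$, then there is a linear automorphism of $(\mathbb C^k)^*$ carrying $\Lambda_j$ to $\Lambda_j'$ for every $j=1,\dots,n$.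
   Context: Let $\mathfrak g=\mathbb C^k$ and let $\Lambda_1,\dots,\Lambda_n\in\mathfrak g^*$ span $\mathfrak g^*$ (weights of the diagonal action $t\cdot z=(e^{\Lambda_j(t)}z_j)_j$ on $\mathbb C^n$). For $I\subset\{1,\dots,n\}$ put $J=I^c$, $r_I=\dim\operatorname{Span}\{\Lambda_i:i\in I\}$, $\mathfrak h_I=\bigcap_{i\in I}\ker\Lambda_i$; $I$ is a singular support if $r_I<k$. The linear map $\mu_I:\mathbb C^J\to\mathfrak h_I^*$ sends $e_j$ to $\Lambda_j|_{\mathfrak h_I}$. Put $S_I=\{\alpha\in\mathbb N^J:\mu_I(\alpha)=0\}$ ($0\in\mathbb N$), $M_I=\operatorname{gp}(S_I)\subset\mathbb Z^J$, $Q_I=\operatorname{Spec}\mathbb C[S_I]$, with monomial basis $X^\alpha$ of $\mathbb C[S_I]$. The coordinate-labelled envelope is the quotient germ $q_I:(\mathbb C^J,0)\to(Q_I,o_I)$, $q_I^*X^\alpha=w^\alpha$, with the coordinates $w_j$ labelled by $j\in J$; it amounts to the datum of $S_I$ as a subset of $\mathbb N^J$. When the support weights are linearly independent, for $\alpha\in M_I$ one writes uniquely $\sum_{j\in J}\alpha_j\Lambda_j=\sum_{i\in I}c_i(\alpha)\Lambda_i$, and the logarithmic connection on $\mathcal O_{(\mathbb C^* )^I}\otimes_{\mathbb C}\mathbb C[S_I]$, with labelled coordinates $z_i$ ($i\in I$) on $(\mathbb C^* )^I$, is $\nabla_I=d-\sum_{i\in I}\frac{dz_i}{z_i}\delta_i$,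 where $\delta_i(X^\alpha)=c_i(\alpha)X^\alpha$. *)

theory Defs
  imports
    "HOL-Analysis.Analysis"
    "HOL-Algebra.Ideal"
    "HOL-Library.Poly_Mapping"
    "HOL-Library.Extended_Nat"
    "HOL-Library.FuncSet"
    "HOL-Computational_Algebra.Group_Closure"
begin

section \<open>Weights\<close>

text \<open>
  A linear functional on \<open>\<complex>\<^sup>k\<close> is given by its row of coefficients \<open>l :: complex^'k\<close>, acting by
  \<open>t \<mapsto> scalar_product l t\<close> (the complex bilinear pairing, not the real inner product).
  The two lemmas below say that this identifies \<open>complex^'k\<close> linearly with the dual space.
  A configuration \<open>\<Lambda>\<^sub>1, \<dots>, \<Lambda>\<^sub>n\<close> is a family \<open>\<Lambda> :: 'n \<Rightarrow> complex^'k\<close>; the finite type \<open>'n\<close> is the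
  set of labels.
\<close>

lemma scalar_product_bilinear:
  fixes l m t :: "complex^'k"
  shows "scalar_product (l + m) t = scalar_product l t + scalar_product m t"
    and "scalar_product (c *s l) t = c * scalar_product l t"
    and "scalar_product l (t + u) = scalar_product l t + scalar_product l u"
    and "scalar_product l (c *s t) = c * scalar_product l t"
  by (simp_all add: scalar_product_def algebra_simps sum.distrib sum_distrib_left)

lemma linear_functional_iff_scalar_product:
  fixes f :: "complex^'k \<Rightarrow> complex"
  shows "Vector_Spaces.linear (*s) (*) f \<longleftrightarrow> (\<exists>!l. f = scalar_product l)"
proof
  assume "Vector_Spaces.linear (*s) (*) f"
  then interpret f: Vector_Spaces.linear "(*s)" "(*)" f .
  have "f t = scalar_product (\<chi> m. f (axis m 1)) t" for t
  proof -
    have "f t = f (\<Sum>m\<in>UNIV. t $ m *s axis m 1)"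
      by (simp add: basis_expansion)
    also have "\<dots> = (\<Sum>m\<in>UNIV. t $ m * f (axis m 1))"
      by (simp add: f.sum f.scale)
    finally show ?thesis
      by (simp add: scalar_product_def mult.commute)
  qed
  then have "f = scalar_product (\<chi> m. f (axis m 1))"
    by blast
  moreover have "l = l'" if "scalar_product l = scalar_product l'" for l l' :: "complex^'k"
  proof -
    have "scalar_product l (axis m 1) = l $ m" for l :: "complex^'k" and m
      by (simp add: scalar_product_def axis_def if_distrib cong: if_cong)
    then show ?thesis
      using that by (metis vec_eq_iff)
  qed
  ultimately show "\<exists>!l. f = scalar_product l"
    by metis
next
  assume "\<exists>!l. f = scalar_product l"
  then obtain l where "f = scalar_product l"
    by blast
  then show "Vector_Spaces.linear (*s) (*) f"
    by unfold_locales (simp_all add: scalar_product_bilinear algebra_simps)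
qed

definition spanning :: "('n::finite \<Rightarrow> complex^'k) \<Rightarrow> bool"
  where "spanning \<Lambda> \<longleftrightarrow> vec.span (range \<Lambda>) = UNIV"

definition support_rank :: "('n::finite \<Rightarrow> complex^'k) \<Rightarrow> 'n set \<Rightarrow> nat"
  where "support_rank \<Lambda> I = vec.dim (vec.span (\<Lambda> ` I))"

definition singular_support :: "('n::finite \<Rightarrow> complex^'k) \<Rightarrow> 'n set \<Rightarrow> bool"
  where "singular_support \<Lambda> I \<longleftrightarrow> support_rank \<Lambda> I < CARD('k)"

definition isotropy :: "('n::finite \<Rightarrow> complex^'k) \<Rightarrow> 'n set \<Rightarrow> (complex^'k) set"
  where "isotropy \<Lambda> I = (\<Inter>i\<in>I. {t. scalar_product (\<Lambda> i) t = 0})"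


section \<open>Resonance semigroup and lattice\<close>

text \<open>
  For \<open>A \<subseteq> {1..n}\<close>, the spaces \<open>\<complex>\<^sup>A\<close>, \<open>\<nat>\<^sup>A\<close>, \<open>\<int>\<^sup>A\<close> are realised inside \<open>\<complex>\<^sup>n\<close>, \<open>\<nat>\<^sup>n\<close>, \<open>\<int>\<^sup>n\<close> by
  extension by zero.
\<close>

definition coord_space :: "'n set \<Rightarrow> ('a::zero^'n) set"
  where "coord_space A = {v. \<forall>j. j \<notin> A \<longrightarrow> v $ j = 0}"

definition of_nat_vec :: "nat^'n \<Rightarrow> 'a::semiring_1^'n"
  where "of_nat_vec \<alpha> = (\<chi> j. of_nat (\<alpha> $ j))"

definition of_int_vec :: "int^'n \<Rightarrow> 'a::ring_1^'n"
  where "of_int_vec \<alpha> = (\<chi> j. of_int (\<alpha> $ j))"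

text \<open>The values of \<open>\<mu>\<close> are functionals on the subspace \<open>isotropy \<Lambda> I\<close>, hence restricted to it.\<close>

definition mu :: "('n::finite \<Rightarrow> complex^'k) \<Rightarrow> 'n set \<Rightarrow> complex^'n \<Rightarrow> (complex^'k \<Rightarrow> complex)"
  where "mu \<Lambda> I v = (\<lambda>t\<in>isotropy \<Lambda> I. \<Sum>j\<in>-I. v $ j * scalar_product (\<Lambda> j) t)"

definition mu_kernel :: "('n::finite \<Rightarrow> complex^'k) \<Rightarrow> 'n set \<Rightarrow> (complex^'n) set"
  where "mu_kernel \<Lambda> I = {v \<in> coord_space (-I). mu \<Lambda> I v = (\<lambda>t\<in>isotropy \<Lambda> I. 0)}"

definition resonance_semigroup :: "('n::finite \<Rightarrow> complex^'k) \<Rightarrow> 'n set \<Rightarrow> (nat^'n) set"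
  where "resonance_semigroup \<Lambda> I =
    {\<alpha> \<in> coord_space (-I). mu \<Lambda> I (of_nat_vec \<alpha>) = (\<lambda>t\<in>isotropy \<Lambda> I. 0)}"

definition resonance_lattice :: "('n::finite \<Rightarrow> complex^'k) \<Rightarrow> 'n set \<Rightarrow> (int^'n) set"
  where "resonance_lattice \<Lambda> I = group_closure (of_nat_vec ` resonance_semigroup \<Lambda> I)"

text \<open>
  For a subgroup \<open>M\<close> of \<open>\<int>\<^sup>n\<close>, the space \<open>M \<otimes>\<^sub>\<int> \<complex>\<close> as a subspace of \<open>\<int>\<^sup>n \<otimes>\<^sub>\<int> \<complex> = \<complex>\<^sup>n\<close>
  (\<open>\<complex>\<close> is flat over \<open>\<int>\<close>), that is, the image of \<open>m \<otimes> c \<mapsto> c m\<close>.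
\<close>

definition complexification :: "(int^'n::finite) set \<Rightarrow> (complex^'n) set"
  where "complexification M = vec.span (of_int_vec ` M)"


section \<open>Semigroup algebra and the dimension of its spectrum\<close>

text \<open>
  Elements of \<open>\<complex>[S]\<close> are finitely supported functions \<open>\<nat>\<^sup>n \<Rightarrow>\<^sub>0 \<complex>\<close> with support in \<open>S\<close>; the monomial
  \<open>X\<^sup>\<alpha>\<close> is \<open>Poly_Mapping.single \<alpha> 1\<close>, and multiplication is convolution.
\<close>

definition semigroup_algebra :: "(nat^'n::finite) set \<Rightarrow> ((nat^'n) \<Rightarrow>\<^sub>0 complex) ring"
  where "semigroup_algebra S =
    \<lparr>carrier = {p. Poly_Mapping.keys p \<subseteq> S}, mult = (*), one = 1, zero = 0, add = (+)\<rparr>"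

text \<open>Krull dimension: the supremum of the lengths of strictly increasing chains of prime ideals.\<close>

definition krull_dim :: "('a, 'b) ring_scheme \<Rightarrow> enat"
  where "krull_dim R = Sup {enat d |d. \<exists>P. (\<forall>i\<le>d. primeideal (P i) R) \<and> (\<forall>i<d. P i \<subset> P (Suc i))}"

lemma cring_semigroup_algebra:
  assumes zero: "0 \<in> S" and add: "\<And>a b. a \<in> S \<Longrightarrow> b \<in> S \<Longrightarrow> a + b \<in> S"
  shows "cring (semigroup_algebra S)"
proof (rule cringI)
  show "abelian_group (semigroup_algebra S)"
  proof (rule abelian_groupI)
    fix x assume "x \<in> carrier (semigroup_algebra S)"
    then show "\<exists>y\<in>carrier (semigroup_algebra S). y \<oplus>\<^bsub>semigroup_algebra S\<^esub> x = \<zero>\<^bsub>semigroup_algebra S\<^esub>"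
      by (intro bexI[of _ "- x"]) (simp_all add: semigroup_algebra_def)
  next
    fix x y assume "x \<in> carrier (semigroup_algebra S)" "y \<in> carrier (semigroup_algebra S)"
    then show "x \<oplus>\<^bsub>semigroup_algebra S\<^esub> y \<in> carrier (semigroup_algebra S)"
      using Poly_Mapping.keys_add[of x y] by (auto simp: semigroup_algebra_def)
  qed (simp_all add: semigroup_algebra_def algebra_simps)
  show "comm_monoid (semigroup_algebra S)"
  proof (rule comm_monoidI)
    fix x y assume "x \<in> carrier (semigroup_algebra S)" "y \<in> carrier (semigroup_algebra S)"
    then show "x \<otimes>\<^bsub>semigroup_algebra S\<^esub> y \<in> carrier (semigroup_algebra S)"
      using keys_mult[of x y] add by (fastforce simp: semigroup_algebra_def)
  qed (use zero in \<open>simp_all add: semigroup_algebra_def algebra_simps\<close>)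
qed (simp add: semigroup_algebra_def algebra_simps)

lemma mu_eq_zero_iff:
  "mu \<Lambda> I v = (\<lambda>t\<in>isotropy \<Lambda> I. 0) \<longleftrightarrow>
    (\<forall>t\<in>isotropy \<Lambda> I. (\<Sum>j\<in>-I. v $ j * scalar_product (\<Lambda> j) t) = 0)"
  by (auto simp: mu_def fun_eq_iff)

lemma cring_resonance_algebra: "cring (semigroup_algebra (resonance_semigroup \<Lambda> I))"
  by (rule cring_semigroup_algebra)
    (simp_all add: resonance_semigroup_def mu_eq_zero_iff coord_space_def of_nat_vec_def
      distrib_right sum.distrib)

text \<open>No truncation: spanning configurations satisfy \<open>k \<le> n\<close>.\<close>

definition full_resonance_rank :: "('n::finite \<Rightarrow> complex^'k) \<Rightarrow> 'n set \<Rightarrow> bool"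
  where "full_resonance_rank \<Lambda> I \<longleftrightarrow>
    krull_dim (semigroup_algebra (resonance_semigroup \<Lambda> I)) = enat (CARD('n) - CARD('k))"


section \<open>The logarithmic connection\<close>

text \<open>
  \<open>resonance_coeff \<Lambda> I \<alpha> $ i\<close> is \<open>c\<^sub>i(\<alpha>)\<close>; it is meaningful when the support weights are linearly
  independent, so that the vector \<open>c\<close> is unique.
\<close>

definition resonance_coeff :: "('n::finite \<Rightarrow> complex^'k) \<Rightarrow> 'n set \<Rightarrow> int^'n \<Rightarrow> complex^'n"
  where "resonance_coeff \<Lambda> I \<alpha> = (THE c. c \<in> coord_space I \<and>
    (\<Sum>j\<in>-I. of_int (\<alpha> $ j) *s \<Lambda> j) = (\<Sum>i\<in>I. c $ i *s \<Lambda> i))"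

text \<open>The \<open>\<complex>\<close>-linear map with \<open>\<delta>\<^sub>i(X\<^sup>\<alpha>) = c\<^sub>i(\<alpha>) X\<^sup>\<alpha>\<close>.\<close>

definition delta ::
  "('n::finite \<Rightarrow> complex^'k) \<Rightarrow> 'n set \<Rightarrow> 'n \<Rightarrow> ((nat^'n) \<Rightarrow>\<^sub>0 complex) \<Rightarrow> ((nat^'n) \<Rightarrow>\<^sub>0 complex)"
  where "delta \<Lambda> I i = Poly_Mapping.mapp (\<lambda>\<alpha> x. resonance_coeff \<Lambda> I (of_nat_vec \<alpha>) $ i * x)"

definition torus :: "'n::finite set \<Rightarrow> (complex^'n) set"
  where "torus I = {z \<in> coord_space I. \<forall>i\<in>I. z $ i \<noteq> 0}"

text \<open>
  Holomorphy on an open subset \<open>U\<close> of \<open>\<complex>\<^sup>I\<close>: differentiability along \<open>\<complex>\<^sup>I\<close> with complex linear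
  derivative.
\<close>

definition holomorphic_on_torus :: "(complex^'n::finite \<Rightarrow> complex) \<Rightarrow> (complex^'n) set \<Rightarrow> bool"
  where "holomorphic_on_torus f U \<longleftrightarrow>
    (\<forall>z\<in>U. \<exists>a. (f has_derivative scalar_product a) (at z within U))"

text \<open>
  Sections over \<open>U\<close> of the sheaf \<open>\<O> \<otimes>\<^sub>\<complex> \<complex>[S]\<close>: locally finite sums \<open>\<Sum>\<^sub>\<alpha> f\<^sub>\<alpha> X\<^sup>\<alpha>\<close> with \<open>\<alpha> \<in> S\<close> and
  \<open>f\<^sub>\<alpha>\<close> holomorphic on \<open>U\<close>, viewed as functions \<open>U \<rightarrow> \<complex>[S]\<close>.
\<close>

definition sections ::
  "(nat^'n::finite) set \<Rightarrow> (complex^'n) set \<Rightarrow> (complex^'n \<Rightarrow> ((nat^'n) \<Rightarrow>\<^sub>0 complex)) set"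
  where "sections S U = {s \<in> U \<rightarrow>\<^sub>E carrier (semigroup_algebra S).
    (\<forall>\<alpha>. holomorphic_on_torus (\<lambda>z. Poly_Mapping.lookup (s z) \<alpha>) U) \<and>
    (\<forall>z\<in>U. \<exists>V A. open V \<and> z \<in> V \<and> finite A \<and> (\<forall>w\<in>U \<inter> V. Poly_Mapping.keys (s w) \<subseteq> A))}"

text \<open>
  One-forms on \<open>U\<close> with values in \<open>\<complex>[S]\<close> are functions of a point \<open>z \<in> U\<close> and a tangent vector
  \<open>v \<in> \<complex>\<^sup>I\<close>, so \<open>dz\<^sub>i / z\<^sub>i\<close> is \<open>v\<^sub>i / z\<^sub>i\<close>. The exterior derivative acts on coefficients, and
  \<open>(df)\<^sub>z(v)\<close> is the derivative at \<open>t = 0\<close> of \<open>t \<mapsto> f(z + t v)\<close>.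
\<close>

definition ext_deriv ::
  "(complex^'n::finite \<Rightarrow> ((nat^'n) \<Rightarrow>\<^sub>0 complex)) \<Rightarrow> complex^'n \<Rightarrow> complex^'n \<Rightarrow> ((nat^'n) \<Rightarrow>\<^sub>0 complex)"
  where "ext_deriv s z v =
    Abs_poly_mapping (\<lambda>\<alpha>. deriv (\<lambda>t. Poly_Mapping.lookup (s (z + t *s v)) \<alpha>) 0)"

definition nabla ::
  "('n::finite \<Rightarrow> complex^'k) \<Rightarrow> 'n set \<Rightarrow> (complex^'n \<Rightarrow> ((nat^'n) \<Rightarrow>\<^sub>0 complex)) \<Rightarrow>
    complex^'n \<Rightarrow> complex^'n \<Rightarrow> ((nat^'n) \<Rightarrow>\<^sub>0 complex)"
  where "nabla \<Lambda> I s z v =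
    ext_deriv s z v - (\<Sum>i\<in>I. Poly_Mapping.map ((*) (v $ i / z $ i)) (delta \<Lambda> I i (s z)))"

text \<open>
  The connection as a morphism of sheaves: to an open \<open>U \<subseteq> (\<complex>\<^sup>*)\<^sup>I\<close> and a section \<open>s\<close> over \<open>U\<close> it
  assigns the one-form \<open>\<nabla> s\<close> on \<open>U\<close>. All maps are restricted to their domains, so equality of
  connections is equality of functions.
\<close>

definition log_connection ::
  "('n::finite \<Rightarrow> complex^'k) \<Rightarrow> 'n set \<Rightarrow>
    (complex^'n) set \<times> (complex^'n \<Rightarrow> ((nat^'n) \<Rightarrow>\<^sub>0 complex)) \<Rightarrow>
    (complex^'n) \<times> (complex^'n) \<Rightarrow> ((nat^'n) \<Rightarrow>\<^sub>0 complex)"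
  where "log_connection \<Lambda> I =
    (\<lambda>(U, s) \<in> (SIGMA U:{U. openin (top_of_set (torus I)) U}. sections (resonance_semigroup \<Lambda> I) U).
      \<lambda>(z, v) \<in> U \<times> coord_space I. nabla \<Lambda> I s z v)"

end

(*
  Let P_0 < ... < P_d be a chain of primes in C[S] and pick x_i in P_{i+1} but not in P_i.
  The x_i are algebraically independent: writing a relation in Horner form in x_0, reduction modulo
  P_1 kills its constant term, division by x_0 is allowed modulo P_0, and so on. So the (N+1)^d
  monomials of multidegree at most N in the x_i are linearly independent; they are combinations of
  X^\<alpha> with \<alpha> in S and entries O(N), and there are O(N^r) of these, r being the rank of S. Hence
  dim C[S] is at most r. Since the span of S lies in ker mu_I, of dimension n - k + r_I - |I|,
  full resonance rank forces r_I = |I| and equality of the two spaces.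

  The connection gives the c_i(\<alpha>), and the vectors (\<alpha>, -c(\<alpha>)) for \<alpha> in S span, by the equality just
  found, all linear relations between the weights; a spanning configuration is determined
  up to linear equivalence by its space of linear relations.
*)

theory Submission
  imports Defs
begin

section \<open>Krull dimension of semigroup algebras\<close>

text \<open>Gaussian elimination, one equation of \<open>B\<close> at a time. It will turn an excess
  of monomials over exponents into a linear relation.\<close>

lemma exists_nontrivial_linear_relation:
  fixes f :: "'i \<Rightarrow> 'b \<Rightarrow> 'a::field"
  assumes "finite B" "finite F" "card B < card F"
  shows "\<exists>c. (\<exists>i\<in>F. c i \<noteq> 0) \<and> (\<forall>b\<in>B. (\<Sum>i\<in>F. c i * f i b) = 0)"
  using assms
proof (induction B arbitrary: F f rule: finite_induct)
  case empty
  then have "F \<noteq> {}"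
    by auto
  then show ?case
    by (intro exI[of _ "\<lambda>_. 1"]) auto
next
  case (insert b B)
  show ?case
  proof (cases "\<forall>i\<in>F. f i b = 0")
    case True
    obtain c where "\<exists>i\<in>F. c i \<noteq> 0" "\<forall>b\<in>B. (\<Sum>i\<in>F. c i * f i b) = 0"
      using insert.IH[of F f] insert.prems insert.hyps by auto
    then show ?thesis
      using True by (intro exI[of _ c]) auto
  next
    case False
    then obtain p where p: "p \<in> F" "f p b \<noteq> 0"
      by blast
    \<comment> \<open>Equation \<open>b\<close> eliminates the unknown \<open>p\<close>;
      \<open>g\<close> is the remaining system, whose row \<open>b\<close> vanishes.\<close>
    define g where "g = (\<lambda>i b'. f i b' - f i b / f p b * f p b')"
    obtain c where c: "\<exists>i\<in>F - {p}. c i \<noteq> 0" "\<forall>b\<in>B. (\<Sum>i\<in>F - {p}. c i * g i b) = 0"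
      using insert.IH[of "F - {p}" g] insert.prems insert.hyps p by (auto simp: less_diff_conv)
    \<comment> \<open>Back substitution: \<open>- s\<close> is the value that equation
      \<open>b\<close> forces on the unknown \<open>p\<close>.\<close>
    define s where "s = (\<Sum>i\<in>F - {p}. c i * (f i b / f p b))"
    define c' where "c' = c(p := - s)"
    have "(\<Sum>i\<in>F. c' i * f i b') = (\<Sum>i\<in>F - {p}. c i * g i b')" for b'
    proof -
      have "(\<Sum>i\<in>F. c' i * f i b') = c' p * f p b' + (\<Sum>i\<in>F - {p}. c' i * f i b')"
        using insert.prems p by (simp add: sum.remove)
      also have "(\<Sum>i\<in>F - {p}. c' i * f i b') = (\<Sum>i\<in>F - {p}. c i * f i b')"
        by (intro sum.cong) (auto simp: c'_def)
      also have "c' p * f p b' = - (\<Sum>i\<in>F - {p}. c i * (f i b / f p b) * f p b')"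
        by (simp add: c'_def s_def sum_distrib_right)
      finally show ?thesis
        by (simp add: g_def algebra_simps sum_subtractf)
    qed
    moreover have "g i b = 0" for i
      using p by (simp add: g_def)
    moreover have "\<exists>i\<in>F. c' i \<noteq> 0"
      using c(1) by (auto simp: c'_def)
    ultimately show ?thesis
      using c(2) by (intro exI[of _ c']) auto
  qed
qed

section \<open>Constants, exponent boxes and monomials\<close>

lemma carrier_semigroup_algebra: "p \<in> carrier (semigroup_algebra S) \<longleftrightarrow> Poly_Mapping.keys p \<subseteq> S"
  by (simp add: semigroup_algebra_def)

text \<open>Constants are ring elements here, so closure of ideals under scalars is a case of
  absorption.\<close>

abbreviation scalar :: "complex \<Rightarrow> (nat^'n) \<Rightarrow>\<^sub>0 complex"
  where "scalar \<equiv> Poly_Mapping.single 0"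

lemma lookup_scalar_mult:
  "Poly_Mapping.lookup (scalar c * p) \<alpha> = c * Poly_Mapping.lookup p \<alpha>"
  by (simp add: mult_map_scale_conv_mult[symmetric] Poly_Mapping.map.rep_eq when_def)

text \<open>These cubes exhaust \<open>S\<close> by finite sets; the growth of their cardinalities
  with \<open>D\<close> bounds the dimension.\<close>

definition nat_box :: "(nat^'n) set \<Rightarrow> nat \<Rightarrow> (nat^'n) set"
  where "nat_box S D = {\<alpha> \<in> S. \<forall>j. \<alpha> $ j \<le> D}"

lemma finite_box: "finite (nat_box S D :: (nat^'n::finite) set)"
proof (rule finite_subset)
  show "nat_box S D \<subseteq> vec_lambda ` (UNIV \<rightarrow>\<^sub>E {..D})"
  proof
    fix \<alpha> assume "\<alpha> \<in> nat_box S D"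
    then show "\<alpha> \<in> vec_lambda ` (UNIV \<rightarrow>\<^sub>E {..D})"
      by (intro image_eqI[of _ _ "vec_nth \<alpha>"]) (auto simp: nat_box_def)
  qed
qed (simp add: finite_PiE)

text \<open>The list form lets an induction along a chain of primes strip off one variable at a
  time.\<close>

definition monomial :: "'a::comm_ring_1 list \<Rightarrow> nat list \<Rightarrow> 'a"
  where "monomial xs ms = prod_list (map2 power xs ms)"

lemma monomial_simps [simp]:
  "monomial [] ms = 1"
  "monomial (x # xs) (m # ms) = x ^ m * monomial xs ms"
  by (simp_all add: monomial_def)

section \<open>Ring operations and prime ideals of C[S]\<close>

context
  fixes S :: "(nat^'n::finite) set"
  assumes zero: "0 \<in> S" and add: "\<And>a b. a \<in> S \<Longrightarrow> b \<in> S \<Longrightarrow> a + b \<in> S"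
begin

lemma one_in_semigroup_algebra: "1 \<in> carrier (semigroup_algebra S)"
  using zero by (simp add: carrier_semigroup_algebra)

lemma mult_in_semigroup_algebra:
  assumes "p \<in> carrier (semigroup_algebra S)" "q \<in> carrier (semigroup_algebra S)"
  shows "p * q \<in> carrier (semigroup_algebra S)"
  using assms keys_mult[of p q] add by (fastforce simp: carrier_semigroup_algebra)

lemma power_in_semigroup_algebra:
  "p \<in> carrier (semigroup_algebra S) \<Longrightarrow> p ^ m \<in> carrier (semigroup_algebra S)"
  by (induction m) (auto intro: one_in_semigroup_algebra mult_in_semigroup_algebra)

lemma scalar_in_semigroup_algebra: "scalar c \<in> carrier (semigroup_algebra S)"
  using zero by (simp add: carrier_semigroup_algebra)

lemma sum_in_semigroup_algebra:
  assumes "\<And>i. i \<in> F \<Longrightarrow> p i \<in> carrier (semigroup_algebra S)"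
  shows "(\<Sum>i\<in>F. p i) \<in> carrier (semigroup_algebra S)"
  using assms keys_sum[of p F] by (fastforce simp: carrier_semigroup_algebra)

lemma monomial_in_semigroup_algebra:
  assumes "set xs \<subseteq> carrier (semigroup_algebra S)" "length ms = length xs"
  shows "monomial xs ms \<in> carrier (semigroup_algebra S)"
  using assms(2,1)
  by (induction ms xs rule: list_induct2)
    (auto intro: one_in_semigroup_algebra mult_in_semigroup_algebra power_in_semigroup_algebra)

text \<open>Translates the record based notion of a prime ideal into type class operations.\<close>

lemma primeideal_semigroup_algebraD:
  assumes "primeideal P (semigroup_algebra S)"
  shows "P \<subseteq> carrier (semigroup_algebra S)"
    and "a \<in> P \<Longrightarrow> b \<in> P \<Longrightarrow> a - b \<in> P"
    and "a \<in> P \<Longrightarrow> b \<in> carrier (semigroup_algebra S) \<Longrightarrow> b * a \<in> P"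
    and "0 \<in> P" "1 \<notin> P"
    and "a \<in> carrier (semigroup_algebra S) \<Longrightarrow> b \<in> carrier (semigroup_algebra S) \<Longrightarrow>
      a * b \<in> P \<Longrightarrow> a \<in> P \<or> b \<in> P"
proof -
  interpret primeideal P "semigroup_algebra S" by fact
  have ops: "x \<otimes>\<^bsub>semigroup_algebra S\<^esub> y = x * y" "x \<oplus>\<^bsub>semigroup_algebra S\<^esub> y = x + y"
    "\<one>\<^bsub>semigroup_algebra S\<^esub> = 1" "\<zero>\<^bsub>semigroup_algebra S\<^esub> = 0" for x y
    by (simp_all add: semigroup_algebra_def)
  show sub: "P \<subseteq> carrier (semigroup_algebra S)"
    using Icarr by blast
  show mult: "b * a \<in> P" if "a \<in> P" "b \<in> carrier (semigroup_algebra S)" for a b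
    using I_l_closed[OF that] by (simp add: ops)
  show "a - b \<in> P" if "a \<in> P" "b \<in> P"
  proof -
    \<comment> \<open>Negation is multiplication by the constant -1, so absorption covers
      it.\<close>
    have "scalar (- 1) * b \<in> P"
      by (intro mult that scalar_in_semigroup_algebra)
    moreover have "scalar (- 1) * b = - b"
      by (simp add: single_uminus)
    ultimately show ?thesis
      using additive_subgroup.a_closed[OF additive_subgroup_axioms, of a "- b"] that by (simp add: ops)
  qed
  show "0 \<in> P"
    using additive_subgroup.zero_closed[OF additive_subgroup_axioms] by (simp add: ops)
  show "1 \<notin> P"
    using one_imp_carrier I_notcarr by (auto simp: ops)
  show "a \<in> P \<or> b \<in> P" if "a \<in> carrier (semigroup_algebra S)" "b \<in> carrier (semigroup_algebra S)"
    "a * b \<in> P"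
    using I_prime that by (simp add: ops)
qed

section \<open>Algebraic independence along a chain of primes\<close>

text \<open>Since \<open>x\<close> lies in \<open>Q\<close>, only the constant term
  \<open>g 0\<close> survives modulo \<open>Q\<close>, so it vanishes. What remains is
  \<open>x\<close> times a shorter polynomial, and primality of \<open>P\<close> cancels
  \<open>x\<close>.\<close>

lemma horner_in_primeideal:
  assumes P: "primeideal P (semigroup_algebra S)" and Q: "primeideal Q (semigroup_algebra S)"
    and "P \<subseteq> Q" and x: "x \<in> Q" "x \<notin> P"
    and "\<And>e. e \<le> N \<Longrightarrow> g e \<in> carrier (semigroup_algebra S)"
    and "\<And>e. e \<le> N \<Longrightarrow> g e \<in> Q \<Longrightarrow> g e = 0"
    and "(\<Sum>e\<le>N. x ^ e * g e) \<in> P" and "e \<le> N"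
  shows "g e = 0"
  using assms(6-)
proof (induction N arbitrary: g e)
  case 0
  then show ?case
    using \<open>P \<subseteq> Q\<close> by auto
next
  case (Suc N)
  note xA = subsetD[OF primeideal_semigroup_algebraD(1)[OF Q] x(1)]
  define h where "h = (\<Sum>e\<le>N. x ^ e * g (Suc e))"
  have h: "h \<in> carrier (semigroup_algebra S)"
    unfolding h_def using Suc.prems(1) xA
    by (auto intro!: sum_in_semigroup_algebra mult_in_semigroup_algebra power_in_semigroup_algebra)
  have eq: "(\<Sum>e\<le>Suc N. x ^ e * g e) = g 0 + x * h"
    unfolding sum.atMost_Suc_shift h_def by (simp add: sum_distrib_left mult.assoc)
  have "h * x \<in> Q"
    using primeideal_semigroup_algebraD(3)[OF Q x(1) h] .
  then have "(g 0 + x * h) - h * x \<in> Q"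
    using Suc.prems(3) \<open>P \<subseteq> Q\<close> unfolding eq by (intro primeideal_semigroup_algebraD(2)[OF Q]) auto
  then have g0: "g 0 = 0"
    using Suc.prems(2)[of 0] by (simp add: mult.commute)
  then have "h \<in> P"
    using Suc.prems(3) eq primeideal_semigroup_algebraD(6)[OF P xA h] x(2) by auto
  then have "g (Suc e) = 0" if "e \<le> N" for e
    using Suc.IH[of "\<lambda>e. g (Suc e)" e] Suc.prems(1,2) that by (auto simp: h_def)
  with g0 show ?case
    using \<open>e \<le> Suc N\<close> by (cases e) auto
qed

text \<open>Membership in \<open>P 0\<close> replaces vanishing of the sum because the induction
  tests the coefficients of the powers of \<open>x\<close> modulo \<open>P 1\<close>.\<close>

lemma chain_algebraically_independent:
  assumes "\<And>i. i \<le> length xs \<Longrightarrow> primeideal (P i) (semigroup_algebra S)"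
    and "\<And>i. i < length xs \<Longrightarrow> P i \<subseteq> P (Suc i)"
    and "\<And>i. i < length xs \<Longrightarrow> xs ! i \<in> P (Suc i) - P i"
    and "(\<Sum>ms | set ms \<subseteq> {..N} \<and> length ms = length xs. scalar (c ms) * monomial xs ms) \<in> P 0"
    and "set ms \<subseteq> {..N}" "length ms = length xs"
  shows "c ms = 0"
  using assms
proof (induction xs arbitrary: P c ms)
  case Nil
  have "{ms. set ms \<subseteq> {..N} \<and> length ms = length ([] :: ((nat^'n) \<Rightarrow>\<^sub>0 complex) list)} = {[]}"
    by auto
  \<comment> \<open>With no variables left the sum is a single constant, and a nonzero constant is a
    unit.\<close>
  then have *: "scalar (c []) \<in> P 0"
    using Nil.prems(4) by (simp only:) simp
  have P: "primeideal (P 0) (semigroup_algebra S)"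
    using Nil.prems(1) by simp
  show ?case
  proof (rule ccontr)
    assume "c ms \<noteq> 0"
    then have "scalar (inverse (c [])) * scalar (c []) = 1"
      using Nil.prems by (simp add: mult_single)
    then show False
      using primeideal_semigroup_algebraD(3,5)[OF P] * scalar_in_semigroup_algebra by metis
  qed
next
  case (Cons x xs)
  define L where "L = {ms. set ms \<subseteq> {..N} \<and> length ms = length xs}"
  \<comment> \<open>\<open>g e\<close> is the coefficient of \<open>x ^ e\<close>, a polynomial in
    the remaining elements.\<close>
  define g where "g = (\<lambda>e. \<Sum>ms\<in>L. scalar (c (e # ms)) * monomial xs ms)"
  have P: "primeideal (P 0) (semigroup_algebra S)" "primeideal (P 1) (semigroup_algebra S)"
    using Cons.prems(1)[of 0] Cons.prems(1)[of 1] by auto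
  have xsA: "set xs \<subseteq> carrier (semigroup_algebra S)"
  proof
    fix y assume "y \<in> set xs"
    then obtain i where "i < length xs" "y = xs ! i"
      by (auto simp: in_set_conv_nth)
    then show "y \<in> carrier (semigroup_algebra S)"
      using Cons.prems(3)[of "Suc i"] primeideal_semigroup_algebraD(1)[OF Cons.prems(1)[of "Suc (Suc i)"]]
      by auto
  qed
  \<comment> \<open>The induction hypothesis for the chain that starts at
    \<open>P 1\<close>.\<close>
  have *: "c (e # ms) = 0" if "g e \<in> P 1" "ms \<in> L" for e ms
  proof (rule Cons.IH[where P = "\<lambda>i. P (Suc i)" and c = "\<lambda>ms. c (e # ms)"])
    show "primeideal (P (Suc i)) (semigroup_algebra S)" if "i \<le> length xs" for i
      using Cons.prems(1)[of "Suc i"] that by simp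
    show "P (Suc i) \<subseteq> P (Suc (Suc i))" "xs ! i \<in> P (Suc (Suc i)) - P (Suc i)"
      if "i < length xs" for i
      using Cons.prems(2,3)[of "Suc i"] that by simp_all
    show "(\<Sum>ms | set ms \<subseteq> {..N} \<and> length ms = length xs. scalar (c (e # ms)) * monomial xs ms)
        \<in> P (Suc 0)"
      using \<open>g e \<in> P 1\<close> by (simp add: g_def L_def)
    show "set ms \<subseteq> {..N}" "length ms = length xs"
      using \<open>ms \<in> L\<close> by (simp_all add: L_def)
  qed
  have "(\<Sum>ms | set ms \<subseteq> {..N} \<and> length ms = length (x # xs). scalar (c ms) * monomial (x # xs) ms)
    = (\<Sum>(ms, e)\<in>L \<times> {..N}. scalar (c (e # ms)) * monomial (x # xs) (e # ms))"
    unfolding list.size add_0_right add_Suc_right lists_length_Suc_eq L_def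
    by (subst sum.reindex) (auto simp: inj_on_def intro!: sum.cong)
  also have "\<dots> = (\<Sum>e\<le>N. x ^ e * g e)"
    by (subst sum.cartesian_product[symmetric], subst sum.swap)
      (simp add: g_def sum_distrib_left algebra_simps)
  finally have "(\<Sum>e\<le>N. x ^ e * g e) \<in> P 0"
    using Cons.prems(4) by simp
  moreover have "g e \<in> carrier (semigroup_algebra S)" for e
    unfolding g_def
    by (intro sum_in_semigroup_algebra mult_in_semigroup_algebra scalar_in_semigroup_algebra
        monomial_in_semigroup_algebra xsA) (auto simp: L_def)
  moreover have "g e = 0" if "g e \<in> P 1" for e
    unfolding g_def using *[OF that] by simp
  ultimately have g: "g e = 0" if "e \<le> N" for e
    using horner_in_primeideal[OF P, of x N g e] Cons.prems(2,3)[of 0] that by auto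
  obtain e ms' where ms: "ms = e # ms'"
    using Cons.prems(6) by (cases ms) auto
  \<comment> \<open>Now that \<open>g e\<close> is 0 it lies in \<open>P 1\<close>, so
    \<open>*\<close> applies again and kills its individual coefficients.\<close>
  show ?case
    using *[of e ms'] g[of e] Cons.prems(5,6) primeideal_semigroup_algebraD(4)[OF P(2)]
    by (auto simp: ms L_def)
qed

section \<open>Growth of exponents and the dimension bound\<close>

lemma keys_mult_box:
  assumes "Poly_Mapping.keys (p :: _ \<Rightarrow>\<^sub>0 complex) \<subseteq> nat_box S D" "Poly_Mapping.keys q \<subseteq> nat_box S E"
  shows "Poly_Mapping.keys (p * q) \<subseteq> nat_box S (D + E)"
proof
  fix \<alpha> assume "\<alpha> \<in> Poly_Mapping.keys (p * q)"
  then obtain a b where "\<alpha> = a + b" "a \<in> nat_box S D" "b \<in> nat_box S E"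
    using keys_mult[of p q] assms by blast
  then show "\<alpha> \<in> nat_box S (D + E)"
    by (auto simp: nat_box_def add intro!: add_mono)
qed

lemma keys_power_box:
  assumes "Poly_Mapping.keys (p :: _ \<Rightarrow>\<^sub>0 complex) \<subseteq> nat_box S D"
  shows "Poly_Mapping.keys (p ^ m) \<subseteq> nat_box S (m * D)"
proof (induction m)
  case 0
  then show ?case
    using zero by (simp add: nat_box_def)
next
  case (Suc m)
  then show ?case
    using keys_mult_box[OF assms Suc] by simp
qed

text \<open>For fixed \<open>xs\<close> the side of the box is linear in \<open>N\<close>, which the
  final comparison of powers relies on.\<close>

lemma keys_monomial_box:
  assumes "length ms = length xs" "\<And>x. x \<in> set xs \<Longrightarrow> Poly_Mapping.keys (x :: _ \<Rightarrow>\<^sub>0 complex) \<subseteq> nat_box S D"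
    and "set ms \<subseteq> {..N}"
  shows "Poly_Mapping.keys (monomial xs ms) \<subseteq> nat_box S (length xs * (N * D))"
  using assms
proof (induction ms xs rule: list_induct2)
  case Nil
  then show ?case
    using zero by (simp add: nat_box_def)
next
  case (Cons m ms x xs)
  have "Poly_Mapping.keys (x ^ m) \<subseteq> nat_box S (m * D)"
    using Cons.prems by (intro keys_power_box) auto
  also have "\<dots> \<subseteq> nat_box S (N * D)"
    using Cons.prems(2) by (auto simp: nat_box_def intro: order_trans[OF _ mult_right_mono])
  finally have "Poly_Mapping.keys (x ^ m) \<subseteq> nat_box S (N * D)" .
  then show ?case
    using keys_mult_box[OF _ Cons.IH] Cons.prems by simp
qed

text \<open>A chain of length \<open>d\<close> gives \<open>(N + 1) ^ d\<close> independent
  monomials with exponents in a box of side linear in \<open>N\<close>, which has O(N^r) points. A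
  large \<open>N\<close> excludes \<open>d > r\<close>.\<close>

lemma krull_dim_le_growth:
  assumes "\<And>D. card (nat_box S D) \<le> (D + 1) ^ r"
  shows "krull_dim (semigroup_algebra S) \<le> enat r"
  unfolding krull_dim_def
proof (rule Sup_least, clarify)
  fix d P
  assume P: "\<forall>i\<le>d. primeideal (P i) (semigroup_algebra S)" "\<forall>i<d. P i \<subset> P (Suc i)"
  have "\<forall>i. \<exists>x. i < d \<longrightarrow> x \<in> P (Suc i) - P i"
    using P(2) by blast
  then obtain x where x: "\<And>i. i < d \<Longrightarrow> x i \<in> P (Suc i) - P i"
    by metis
  define xs where "xs = map x [0..<d]"
  have len: "length xs = d" and nth: "\<And>i. i < d \<Longrightarrow> xs ! i = x i"
    by (simp_all add: xs_def)
  have xsA: "Poly_Mapping.keys y \<subseteq> S" if y: "y \<in> set xs" for y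
  proof -
    obtain i where "i < d" "y = x i"
      using y by (auto simp: xs_def)
    then show ?thesis
      using x[of i] P(1) primeideal_semigroup_algebraD(1)[of "P (Suc i)"]
      by (metis DiffD1 Suc_leI carrier_semigroup_algebra subsetD)
  qed
  \<comment> \<open>A common bound for all exponents in the \<open>x i\<close>; the inserted 0 keeps
    the set nonempty when \<open>d\<close> is 0.\<close>
  define D where "D = Max (insert 0 ((\<lambda>(\<alpha>, j). \<alpha> $ j) ` ((\<Union>y\<in>set xs. Poly_Mapping.keys y) \<times> UNIV)))"
  have box: "Poly_Mapping.keys y \<subseteq> nat_box S D" if "y \<in> set xs" for y
  proof
    fix \<alpha> assume \<alpha>: "\<alpha> \<in> Poly_Mapping.keys y"
    have "\<alpha> $ j \<le> D" for j
      unfolding D_def using that \<alpha> by (intro Max_ge) (auto intro!: image_eqI[of _ _ "(\<alpha>, j)"])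
    then show "\<alpha> \<in> nat_box S D"
      using \<alpha> xsA[OF that] by (auto simp: nat_box_def)
  qed
  have growth: "(N + 1) ^ d \<le> (d * (N * D) + 1) ^ r" for N
  proof (rule ccontr)
    define L where "L = {ms. set ms \<subseteq> {..N} \<and> length ms = length xs}"
    assume "\<not> ?thesis"
    then have "card (nat_box S (d * (N * D))) < card L"
      using assms[of "d * (N * D)"] by (simp add: L_def card_lists_length_eq len)
    \<comment> \<open>One unknown per monomial, one equation per exponent in the box.\<close>
    then obtain c where c: "\<exists>ms\<in>L. c ms \<noteq> 0"
      "\<And>\<alpha>. \<alpha> \<in> nat_box S (d * (N * D)) \<Longrightarrow> (\<Sum>ms\<in>L. c ms * Poly_Mapping.lookup (monomial xs ms) \<alpha>) = 0"
      using exists_nontrivial_linear_relation[OF finite_box, of L S "d * (N * D)"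
          "\<lambda>ms. Poly_Mapping.lookup (monomial xs ms)"]
      by (auto simp: L_def finite_lists_length_eq)
    have "(\<Sum>ms\<in>L. scalar (c ms) * monomial xs ms) = 0"
    proof (rule poly_mapping_eqI)
      fix \<alpha>
      show "Poly_Mapping.lookup (\<Sum>ms\<in>L. scalar (c ms) * monomial xs ms) \<alpha> = Poly_Mapping.lookup 0 \<alpha>"
      proof (cases "\<alpha> \<in> nat_box S (d * (N * D))")
        case True
        then show ?thesis
          using c(2) by (simp add: lookup_sum lookup_scalar_mult)
      next
        case False
        have "Poly_Mapping.lookup (monomial xs ms) \<alpha> = 0" if "ms \<in> L" for ms
          using False keys_monomial_box[of ms xs D N] box that
          by (auto simp: L_def len in_keys_iff subset_iff)
        then show ?thesis
          by (simp add: lookup_sum lookup_scalar_mult)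
      qed
    qed
    moreover have "0 \<in> P 0"
      using primeideal_semigroup_algebraD(4) P(1) by blast
    ultimately have "c ms = 0" if "ms \<in> L" for ms
      using that P x by (intro chain_algebraically_independent[where xs = xs and P = P and N = N])
        (auto simp: len nth L_def)
    with c(1) show False
      by blast
  qed
  have "d \<le> r"
  proof (rule ccontr)
    assume "\<not> d \<le> r"
    \<comment> \<open>This \<open>N\<close> absorbs the constant factor: the upper bound becomes
      \<open>(N + 1) ^ r * N\<close>, less than \<open>(N + 1) ^ r * (N + 1)\<close>.\<close>
    define N where "N = (d * D + 1) ^ r"
    have "(N + 1) ^ r * (N + 1) \<le> (N + 1) ^ d"
      using \<open>\<not> d \<le> r\<close> power_increasing[of "Suc r" d "N + 1"] by (simp add: algebra_simps)
    also have "\<dots> \<le> (d * (N * D) + 1) ^ r"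
      by (rule growth)
    also have "\<dots> \<le> ((d * D + 1) * (N + 1)) ^ r"
      by (intro power_mono) (auto simp: algebra_simps)
    also have "\<dots> = (N + 1) ^ r * N"
      by (metis N_def mult.commute power_mult_distrib)
    finally show False
      by simp
  qed
  then show "enat d \<le> enat r"
    by simp
qed

end


section \<open>Lattice points and subspaces\<close>

text \<open>A smallest set of coordinates detecting zero on \<open>V\<close> works: by minimality
  each member has a vector of \<open>V\<close> on which it is the only nonzero coordinate of the
  set, and these vectors are independent.\<close>

lemma exists_coordinates_injective_on_subspace:
  fixes V :: "('a::field^'n::finite) set"
  assumes V: "vec.subspace V"
  shows "\<exists>R. card R \<le> vec.dim V \<and> (\<forall>v\<in>V. (\<forall>j\<in>R. v $ j = 0) \<longrightarrow> v = 0)"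
proof -
  define inj where "inj R \<longleftrightarrow> (\<forall>v\<in>V. (\<forall>j\<in>R. v $ j = 0) \<longrightarrow> v = 0)" for R
  have "inj UNIV"
    by (simp add: inj_def vec_eq_iff)
  then obtain R where R: "inj R" and min: "\<And>R'. inj R' \<Longrightarrow> card R \<le> card R'"
    using ex_has_least_nat[of inj UNIV card] by blast
  have "\<exists>v\<in>V. (\<forall>j\<in>R - {i}. v $ j = 0) \<and> v $ i \<noteq> 0" if "i \<in> R" for i
  proof -
    have "card (R - {i}) < card R"
      using that by (intro psubset_card_mono) auto
    then have "\<not> inj (R - {i})"
      using min by (meson leD)
    then obtain v where "v \<in> V" "\<forall>j\<in>R - {i}. v $ j = 0" "v \<noteq> 0"
      by (auto simp: inj_def)
    then show ?thesis
      using R unfolding inj_def by (intro bexI[of _ v]) auto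
  qed
  then obtain v where v: "\<And>i. i \<in> R \<Longrightarrow> v i \<in> V" "\<And>i. i \<in> R \<Longrightarrow> v i $ i \<noteq> 0"
    "\<And>i j. i \<in> R \<Longrightarrow> j \<in> R \<Longrightarrow> j \<noteq> i \<Longrightarrow> v i $ j = 0"
    by (metis insertE insert_Diff Diff_iff singletonD)
  have inj: "inj_on v R"
    by (intro inj_onI) (metis v(2,3))
  have "vec.independent (v ` R)"
  proof (rule vec.independent_if_scalars_zero)
    fix c x assume sum: "(\<Sum>x\<in>v ` R. c x *s x) = 0" and "x \<in> v ` R"
    then obtain i where i: "i \<in> R" "x = v i"
      by blast
    \<comment> \<open>Coordinate \<open>i\<close> kills every summand except the one at
      \<open>i\<close>.\<close>
    have "0 = (\<Sum>j\<in>R. c (v j) *s v j) $ i"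
      using sum by (simp add: sum.reindex[OF inj])
    also have "\<dots> = (\<Sum>j\<in>R. if j = i then c (v i) * v i $ i else 0)"
      unfolding sum_component using v(3) i by (intro sum.cong) auto
    finally show "c x = 0"
      using v(2)[OF i(1)] i by simp
  qed simp
  then have "card (v ` R) \<le> vec.dim V"
    using v(1) by (intro vec.independent_card_le_dim) auto
  then show ?thesis
    using R inj by (intro exI[of _ R]) (simp add: inj_def card_image)
qed

text \<open>The coordinates in \<open>R\<close> determine a point of the span, and each takes at
  most \<open>D + 1\<close> values on the box.\<close>

lemma card_nat_box_le:
  fixes S :: "(nat^'n::finite) set"
  shows "card (nat_box S D) \<le> (D + 1) ^ vec.dim (vec.span (of_nat_vec ` S :: (complex^'n) set))"
proof -
  let ?V = "vec.span (of_nat_vec ` S :: (complex^'n) set)"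
  obtain R where R: "card R \<le> vec.dim ?V" "\<And>v. v \<in> ?V \<Longrightarrow> \<forall>j\<in>R. v $ j = 0 \<Longrightarrow> v = 0"
    using exists_coordinates_injective_on_subspace[OF vec.subspace_span] by blast
  have "inj_on (\<lambda>\<alpha>. restrict (vec_nth \<alpha>) R) (nat_box S D)"
  proof (rule inj_onI)
    fix \<alpha> \<beta> :: "nat^'n"
    assume *: "\<alpha> \<in> nat_box S D" "\<beta> \<in> nat_box S D" "restrict (vec_nth \<alpha>) R = restrict (vec_nth \<beta>) R"
    have "of_nat_vec \<alpha> - of_nat_vec \<beta> \<in> ?V"
      using * by (intro vec.span_diff vec.span_base) (auto simp: nat_box_def)
    moreover have "\<alpha> $ j = \<beta> $ j" if "j \<in> R" for j
      using *(3) that by (metis restrict_apply')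
    ultimately have "of_nat_vec \<alpha> - of_nat_vec \<beta> = (0 :: complex^'n)"
      by (intro R(2)) (auto simp: of_nat_vec_def)
    then show "\<alpha> = \<beta>"
      by (simp add: of_nat_vec_def vec_eq_iff)
  qed
  then have "card (nat_box S D) \<le> card (R \<rightarrow>\<^sub>E {..D})"
    by (rule card_inj_on_le) (auto simp: nat_box_def finite_PiE)
  also have "\<dots> = (D + 1) ^ card R"
    by (simp add: card_PiE)
  also have "\<dots> \<le> (D + 1) ^ vec.dim ?V"
    using R(1) by (intro power_increasing) auto
  finally show ?thesis .
qed

section \<open>Annihilators and preimages of subspaces\<close>

text \<open>Double annihilator: a \<open>w\<close> outside the span is separated from it by a
  functional that is 1 at \<open>w\<close> and 0 on a basis of the span.\<close>

lemma in_span_iff_annihilator: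
  fixes B :: "(complex^'k::finite) set"
  shows "w \<in> vec.span B \<longleftrightarrow> (\<forall>t. (\<forall>b\<in>B. scalar_product b t = 0) \<longrightarrow> scalar_product w t = 0)"
proof
  assume "w \<in> vec.span B"
  then show "\<forall>t. (\<forall>b\<in>B. scalar_product b t = 0) \<longrightarrow> scalar_product w t = 0"
  proof (induction rule: vec.span_induct_alt)
    case base
    then show ?case
      by (simp add: scalar_product_def)
  qed (simp add: scalar_product_bilinear)
next
  assume *: "\<forall>t. (\<forall>b\<in>B. scalar_product b t = 0) \<longrightarrow> scalar_product w t = 0"
  show "w \<in> vec.span B"
  proof (rule ccontr)
    assume "w \<notin> vec.span B"
    obtain C where C: "C \<subseteq> B" "vec.independent C" "B \<subseteq> vec.span C"
      using vec.maximal_independent_subset by blast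
    have "w \<notin> vec.span C"
      using \<open>w \<notin> vec.span B\<close> vec.span_mono[OF C(1)] by blast
    then have "vec.independent (insert w C)"
      using C(2) by (simp add: vec.independent_insert)
    \<comment> \<open>The vector \<open>1\<close> has all coordinates 1, so any coordinate of
      \<open>g\<close> is a functional with value 1 at \<open>w\<close>.\<close>
    then obtain g :: "complex^'k \<Rightarrow> complex^'k"
      where g: "Vector_Spaces.linear (*s) (*s) g"
        "\<And>x. x \<in> insert w C \<Longrightarrow> g x = (if x = w then 1 else 0)"
      using vec.linear_independent_extend[of "insert w C" "\<lambda>x. if x = w then 1 else 0"] by blast
    interpret g: Vector_Spaces.linear "(*s)" "(*s)" g
      by (rule g(1))
    obtain m :: 'k where True by blast
    have "Vector_Spaces.linear (*s) (*) (\<lambda>x. g x $ m)"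
      by unfold_locales (simp_all add: g.add g.scale algebra_simps)
    then obtain l where l: "\<And>x. g x $ m = scalar_product l x"
      unfolding linear_functional_iff_scalar_product by metis
    have "g b = 0" if "b \<in> B" for b
    proof -
      have "b \<in> vec.span C"
        using C(3) that by blast
      then show ?thesis
      proof (induction rule: vec.span_induct_alt)
        case (step c x y)
        have "g x = 0"
          using g(2)[of x] step(1) \<open>w \<notin> vec.span C\<close> vec.span_base by fastforce
        then show ?case
          using step by (simp add: g.add g.scale)
      qed (simp add: g.zero)
    qed
    \<comment> \<open>The pairing is symmetric, so the row \<open>l\<close> of the functional serves
      as the point \<open>t\<close>.\<close>
    then have "scalar_product b l = 0" if "b \<in> B" for b
      using l[of b] that by (simp add: scalar_product_def mult.commute)
    moreover have "scalar_product w l = 1"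
      using l[of w] g(2)[of w] by (simp add: scalar_product_def mult.commute)
    ultimately show False
      using * by simp
  qed
qed

text \<open>A complement of \<open>T\<close> lifts along a right inverse of \<open>f\<close> to a
  subspace of the same dimension that meets the preimage of \<open>T\<close> only in 0.\<close>

lemma dim_vimage_linear_le:
  fixes f :: "'a::field^'n::finite \<Rightarrow> 'a^'k::finite"
  assumes f: "Vector_Spaces.linear (*s) (*s) f" "surj f" and T: "vec.subspace T"
  shows "vec.dim (f -` T) + CARD('k) \<le> CARD('n) + vec.dim T"
proof -
  interpret f: Vector_Spaces.linear "(*s)" "(*s)" f
    by (rule f(1))
  obtain g where g: "Vector_Spaces.linear (*s) (*s) g" "\<And>y. f (g y) = y"
    using vec.linear_surjective_right_inverse[OF f] by (auto simp: fun_eq_iff)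
  obtain B where B: "B \<subseteq> T" "vec.independent B" "T \<subseteq> vec.span B" "card B = vec.dim T"
    using vec.basis_exists by blast
  obtain C where C: "B \<subseteq> C" "vec.independent C" "UNIV \<subseteq> vec.span C"
    using vec.maximal_independent_subset_extend[OF subset_UNIV B(2)] by metis
  have "vec.span C = vec.span UNIV"
    using C(3) vec.span_UNIV by blast
  then have cardC: "card C = CARD('k)"
    using vec.dim_eq_card[OF _ C(2)] vec_dim_card by metis
  have fin: "finite C"
    using C(2) vec.finiteI_independent by blast
  \<comment> \<open>The basis vectors added to \<open>B\<close> span a complement of
    \<open>T\<close>.\<close>
  define D where "D = vec.span (C - B)"
  have dimD: "vec.dim D = CARD('k) - vec.dim T"
    using vec.dim_eq_card_independent[of "C - B"] vec.independent_mono[OF C(2)] B(4) C(1) cardC fin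
    by (simp add: D_def card_Diff_subset finite_subset)
  have "{x + y |x y. x \<in> T \<and> y \<in> D} = UNIV"
  proof -
    have "vec.span B = T"
      using B T by (simp add: vec.span_subspace)
    then show ?thesis
      using C vec.span_Un[of B "C - B"] by (auto simp: D_def Un_absorb1)
  qed
  then have "CARD('k) + vec.dim (T \<inter> D) = vec.dim T + vec.dim D"
    using vec.dim_sums_Int[OF T, of D] by (simp add: D_def vec_dim_card card_cart_basis)
  moreover have le: "vec.dim T \<le> CARD('k)"
    using B(4) C(1) cardC fin by (metis card_mono)
  ultimately have "vec.dim (T \<inter> D) = 0"
    using dimD by simp
  then have TD: "T \<inter> D \<subseteq> {0}"
    by simp
  have "f -` T \<inter> g ` D \<subseteq> {0}"
    using TD vec.linear_0[OF g(1)] by (auto simp: g(2))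
  then have 0: "vec.dim (f -` T \<inter> g ` D) = 0"
    by simp
  have "vec.dim (g ` D) = vec.dim D"
    using g by (intro vec.dim_image_eq) (auto intro: inj_on_inverseI)
  moreover have "vec.subspace (f -` T)"
    using T by (rule f.subspace_vimage)
  moreover have "vec.subspace (g ` D)"
    unfolding D_def using g(1) vec.linear_subspace_image vec.subspace_span by blast
  ultimately have "vec.dim (f -` T) + vec.dim D = vec.dim {x + y |x y. x \<in> f -` T \<and> y \<in> g ` D}"
    using vec.dim_sums_Int[of "f -` T" "g ` D"] 0 by simp
  also have "\<dots> \<le> vec.dim (UNIV :: ('a^'n) set)"
    by (rule vec.dim_subset) simp
  also have "\<dots> = CARD('n)"
    by (rule vec_dim_card)
  finally show ?thesis
    using dimD le by simp
qed


section \<open>Linear relations between weights\<close>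

text \<open>Its kernel is the space of linear relations between the weights, through which
  configurations are compared.\<close>

definition weight_sum :: "('n::finite \<Rightarrow> complex^'k) \<Rightarrow> complex^'n \<Rightarrow> complex^'k"
  where "weight_sum \<Lambda> v = (\<Sum>j\<in>UNIV. v $ j *s \<Lambda> j)"

lemma linear_weight_sum: "Vector_Spaces.linear (*s) (*s) (weight_sum \<Lambda>)"
  by unfold_locales
    (simp_all add: weight_sum_def algebra_simps vec.scale_left_distrib sum.distrib vec.scale_sum_right)

lemma weight_sum_axis [simp]: "weight_sum \<Lambda> (axis j 1) = \<Lambda> j"
  by (simp add: weight_sum_def axis_def if_distrib[of "\<lambda>c. c *s _"] cong: if_cong)

lemma surj_weight_sum:
  assumes "spanning \<Lambda>"
  shows "surj (weight_sum \<Lambda>)"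
proof -
  interpret Vector_Spaces.linear "(*s)" "(*s)" "weight_sum \<Lambda>"
    by (rule linear_weight_sum)
  have "vec.span (range \<Lambda>) \<subseteq> range (weight_sum \<Lambda>)"
    by (intro vec.span_minimal subspace_image vec.subspace_UNIV) (metis image_subsetI rangeI weight_sum_axis)
  then show ?thesis
    using assms by (auto simp: spanning_def)
qed

lemma weight_sum_coord_space:
  assumes "v \<in> coord_space A"
  shows "weight_sum \<Lambda> v = (\<Sum>j\<in>A. v $ j *s \<Lambda> j)"
  unfolding weight_sum_def using assms
  by (intro sum.mono_neutral_right) (auto simp: coord_space_def)

lemma weight_sum_coord_space_in_span:
  assumes "v \<in> coord_space I"
  shows "weight_sum \<Lambda> v \<in> vec.span (\<Lambda> ` I)"
  unfolding weight_sum_coord_space[OF assms]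
  by (intro vec.span_sum vec.span_scale) (simp add: vec.span_base)

lemma subspace_coord_space: "vec.subspace (coord_space A :: ('a::field^'n) set)"
  by (rule vec.subspaceI) (auto simp: coord_space_def)

lemma card_le_dim_coord_space: "card A \<le> vec.dim (coord_space A :: ('a::field^'n::finite) set)"
proof -
  have "vec.independent ((\<lambda>j. axis j 1 :: 'a^'n) ` A)"
    by (rule vec.independent_mono[OF independent_cart_basis]) (auto simp: cart_basis_def)
  moreover have "(\<lambda>j. axis j 1 :: 'a^'n) ` A \<subseteq> coord_space A"
    by (auto simp: coord_space_def axis_def)
  moreover have "inj_on (\<lambda>j. axis j 1 :: 'a^'n) A"
    by (auto simp: inj_on_def axis_eq_axis)
  ultimately show ?thesis
    using vec.independent_card_le_dim by (metis card_image)
qed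

lemma scalar_product_weight_sum:
  "scalar_product (weight_sum \<Lambda> v) t = (\<Sum>j\<in>UNIV. v $ j * scalar_product (\<Lambda> j) t)"
proof -
  have "scalar_product (\<Sum>j\<in>A. v $ j *s \<Lambda> j) t = (\<Sum>j\<in>A. v $ j * scalar_product (\<Lambda> j) t)" for A
    by (induction A rule: infinite_finite_induct)
      (simp_all add: scalar_product_bilinear, simp_all add: scalar_product_def)
  then show ?thesis
    by (simp add: weight_sum_def)
qed

text \<open>The isotropy space is the annihilator of the support weights, so a functional vanishes
  on it exactly when it lies in their span.\<close>

lemma mu_kernel_eq: "mu_kernel \<Lambda> I = coord_space (- I) \<inter> weight_sum \<Lambda> -` vec.span (\<Lambda> ` I)"
proof -
  have "mu \<Lambda> I v = (\<lambda>t\<in>isotropy \<Lambda> I. 0) \<longleftrightarrow> weight_sum \<Lambda> v \<in> vec.span (\<Lambda> ` I)"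
    if "v \<in> coord_space (- I)" for v
  proof -
    have "(\<Sum>j\<in>- I. v $ j * scalar_product (\<Lambda> j) t) = scalar_product (weight_sum \<Lambda> v) t" for t
      unfolding scalar_product_weight_sum using that
      by (intro sum.mono_neutral_left) (auto simp: coord_space_def)
    moreover have "t \<in> isotropy \<Lambda> I \<longleftrightarrow> (\<forall>b\<in>\<Lambda> ` I. scalar_product b t = 0)" for t
      by (simp add: isotropy_def)
    ultimately show ?thesis
      unfolding mu_eq_zero_iff in_span_iff_annihilator by auto
  qed
  then show ?thesis
    by (auto simp: mu_kernel_def)
qed

lemma subspace_mu_kernel: "vec.subspace (mu_kernel \<Lambda> I)"
proof -
  interpret Vector_Spaces.linear "(*s)" "(*s)" "weight_sum \<Lambda>"
    by (rule linear_weight_sum)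
  show ?thesis
    unfolding mu_kernel_eq
    by (intro vec.subspace_inter subspace_coord_space subspace_vimage vec.subspace_span)
qed

text \<open>The kernel of mu_I and C^I have complementary supports, so their sum is direct; it lies
  in the preimage of the span of the support weights, of dimension at most n - k + r_I.\<close>

lemma dim_mu_kernel_le:
  fixes \<Lambda> :: "'n::finite \<Rightarrow> complex^'k::finite"
  assumes "spanning \<Lambda>"
  shows "vec.dim (mu_kernel \<Lambda> I) + card I + CARD('k) \<le> CARD('n) + support_rank \<Lambda> I"
proof -
  interpret Vector_Spaces.linear "(*s)" "(*s)" "weight_sum \<Lambda>"
    by (rule linear_weight_sum)
  let ?U = "weight_sum \<Lambda> -` vec.span (\<Lambda> ` I)"
  let ?C = "coord_space I :: (complex^'n) set"
  have U: "vec.subspace ?U"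
    by (intro subspace_vimage vec.subspace_span)
  have "?C \<subseteq> ?U"
    by (auto intro: weight_sum_coord_space_in_span)
  then have "{x + y |x y. x \<in> mu_kernel \<Lambda> I \<and> y \<in> ?C} \<subseteq> ?U"
    using vec.subspace_add[OF U] by (auto simp: mu_kernel_eq)
  then have "vec.dim {x + y |x y. x \<in> mu_kernel \<Lambda> I \<and> y \<in> ?C} \<le> vec.dim ?U"
    by (rule vec.dim_subset)
  moreover have "mu_kernel \<Lambda> I \<inter> ?C \<subseteq> {0}"
    by (auto simp: mu_kernel_eq coord_space_def vec_eq_iff) metis
  then have "vec.dim (mu_kernel \<Lambda> I \<inter> ?C) = 0"
    by simp
  moreover have "card I \<le> vec.dim ?C"
    by (rule card_le_dim_coord_space)
  ultimately have "vec.dim (mu_kernel \<Lambda> I) + vec.dim ?C \<le> vec.dim ?U"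
    using vec.dim_sums_Int[OF subspace_mu_kernel subspace_coord_space, of \<Lambda> I I] by linarith
  then show ?thesis
    using \<open>card I \<le> vec.dim ?C\<close>
      dim_vimage_linear_le[OF linear_weight_sum surj_weight_sum[OF assms] vec.subspace_span, of "\<Lambda> ` I"]
    by (simp add: support_rank_def)
qed

section \<open>Consequences of full resonance rank\<close>

text \<open>Differences of exponent vectors stay in their complex span, so passing from semigroup to
  lattice adds nothing.\<close>

lemma complexification_resonance_lattice:
  fixes \<Lambda> :: "'n::finite \<Rightarrow> complex^'k::finite"
  shows "complexification (resonance_lattice \<Lambda> I) =
    vec.span (of_nat_vec ` resonance_semigroup \<Lambda> I)"
proof -
  let ?S = "resonance_semigroup \<Lambda> I"
  let ?V = "vec.span (of_nat_vec ` ?S :: (complex^'n) set)"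
  have nat_int: "of_int_vec (of_nat_vec \<alpha> :: int^'n) = (of_nat_vec \<alpha> :: complex^'n)" for \<alpha> :: "nat^'n"
    by (simp add: of_int_vec_def of_nat_vec_def)
  have "of_int_vec \<alpha> \<in> ?V" if "\<alpha> \<in> resonance_lattice \<Lambda> I" for \<alpha>
    using that unfolding resonance_lattice_def
  proof (induction rule: group_closure.induct)
    case (base s)
    \<comment> \<open>\<open>group_closure\<close> adjoins 0 to the generators, hence two
      cases.\<close>
    then consider "s = 0" | \<alpha> where "\<alpha> \<in> ?S" "s = of_nat_vec \<alpha>"
      by blast
    then show ?case
    proof cases
      case 1
      then have "of_int_vec s = (0 :: complex^'n)"
        by (simp add: of_int_vec_def vec_eq_iff)
      then show ?thesis
        by (simp add: vec.span_zero)
    next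
      case 2
      then show ?thesis
        using nat_int by (auto intro: vec.span_base)
    qed
  next
    case (diff s t)
    have "of_int_vec (s - t) = (of_int_vec s - of_int_vec t :: complex^'n)"
      by (simp add: of_int_vec_def vec_eq_iff)
    then show ?case
      using diff by (simp add: vec.span_diff)
  qed
  moreover have "of_nat_vec ` ?S \<subseteq> (of_int_vec ` resonance_lattice \<Lambda> I :: (complex^'n) set)"
  proof
    fix v :: "complex^'n" assume "v \<in> of_nat_vec ` ?S"
    then obtain \<alpha> where "\<alpha> \<in> ?S" "v = of_int_vec (of_nat_vec \<alpha>)"
      using nat_int by auto
    then show "v \<in> of_int_vec ` resonance_lattice \<Lambda> I"
      unfolding resonance_lattice_def by (auto intro: group_closure.base)
  qed
  ultimately show ?thesis
    unfolding complexification_def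
    by (intro subset_antisym vec.span_mono vec.span_minimal vec.subspace_span) auto
qed

lemma of_nat_vec_in_mu_kernel:
  "\<alpha> \<in> resonance_semigroup \<Lambda> I \<Longrightarrow> of_nat_vec \<alpha> \<in> mu_kernel \<Lambda> I"
  by (auto simp: resonance_semigroup_def mu_kernel_def coord_space_def of_nat_vec_def)

text \<open>The bounds close up: n - k is at most the dimension of the span of the semigroup, hence
  of ker mu_I, hence at most n - k + r_I - |I|, while r_I is at most |I|.\<close>

lemma full_resonance_rank_imp:
  fixes \<Lambda> :: "'n::finite \<Rightarrow> complex^'k::finite"
  assumes "spanning \<Lambda>" and "full_resonance_rank \<Lambda> I"
  shows "support_rank \<Lambda> I = card I"
    and "complexification (resonance_lattice \<Lambda> I) = mu_kernel \<Lambda> I"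
    and "inj_on \<Lambda> I" and "vec.independent (\<Lambda> ` I)"
proof -
  let ?S = "resonance_semigroup \<Lambda> I"
  let ?V = "vec.span (of_nat_vec ` ?S :: (complex^'n) set)"
  have "krull_dim (semigroup_algebra ?S) \<le> enat (vec.dim ?V)"
    by (rule krull_dim_le_growth[OF _ _ card_nat_box_le])
      (simp_all add: resonance_semigroup_def mu_eq_zero_iff coord_space_def of_nat_vec_def
        distrib_right sum.distrib)
  then have "CARD('n) - CARD('k) \<le> vec.dim ?V"
    using assms(2) by (simp add: full_resonance_rank_def)
  moreover have sub: "?V \<subseteq> mu_kernel \<Lambda> I"
    using subspace_mu_kernel of_nat_vec_in_mu_kernel by (intro vec.span_minimal) auto
  then have "vec.dim ?V \<le> vec.dim (mu_kernel \<Lambda> I)"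
    by (rule vec.dim_subset)
  \<comment> \<open>Makes the truncated difference n - k exact.\<close>
  moreover have "CARD('k) \<le> CARD('n)"
    using vec.dim_image_le[OF linear_weight_sum, of \<Lambda> UNIV] surj_weight_sum[OF assms(1)] vec_dim_card
    by metis
  moreover have rank: "support_rank \<Lambda> I \<le> card (\<Lambda> ` I)"
    by (simp add: support_rank_def vec.dim_le_card')
  moreover have "card (\<Lambda> ` I) \<le> card I"
    by (simp add: card_image_le)
  \<comment> \<open>The number of distinct support weights lies between r_I and |I|; equality with
    |I| gives injectivity, equality with r_I independence.\<close>
  ultimately have eq: "card (\<Lambda> ` I) = card I" "support_rank \<Lambda> I = card I"
    "vec.dim (mu_kernel \<Lambda> I) \<le> vec.dim ?V"
    using dim_mu_kernel_le[OF assms(1), of I] by linarith+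
  show "support_rank \<Lambda> I = card I"
    by (rule eq)
  show "complexification (resonance_lattice \<Lambda> I) = mu_kernel \<Lambda> I"
    unfolding complexification_resonance_lattice
    by (rule vec.subspace_dim_equal[OF vec.subspace_span subspace_mu_kernel sub eq(3)])
  show "inj_on \<Lambda> I"
    using eq(1) by (intro eq_card_imp_inj_on) auto
  show "vec.independent (\<Lambda> ` I)"
    using eq by (intro vec.card_le_dim_spanning[of _ "vec.span (\<Lambda> ` I)"])
      (auto simp: support_rank_def intro: vec.span_base)
qed

section \<open>Resonance coefficients and the connection\<close>

text \<open>\<open>vec.independent\<close> concerns the set of weights, so coefficients move from
  labels to weights through the inverse of \<open>\<Lambda>\<close> on \<open>I\<close>.\<close>

lemma weight_sum_eq_0_coord_space:
  assumes "inj_on \<Lambda> I" "vec.independent (\<Lambda> ` I)" and v: "v \<in> coord_space I" "weight_sum \<Lambda> v = 0"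
  shows "v = 0"
proof -
  have "(\<Sum>x\<in>\<Lambda> ` I. v $ the_inv_into I \<Lambda> x *s x) = (\<Sum>i\<in>I. v $ i *s \<Lambda> i)"
    using assms(1) by (simp add: sum.reindex the_inv_into_f_f)
  also have "\<dots> = 0"
    using v by (simp add: weight_sum_coord_space)
  finally have sum: "(\<Sum>x\<in>\<Lambda> ` I. v $ the_inv_into I \<Lambda> x *s x) = 0" .
  have "v $ the_inv_into I \<Lambda> x = 0" if "x \<in> \<Lambda> ` I" for x
    by (rule vec.independentD[OF assms(2) _ subset_refl sum that]) simp
  then have "v $ i = 0" if "i \<in> I" for i
    using assms(1) that by (metis imageI the_inv_into_f_f)
  then show ?thesis
    using v(1) unfolding vec_eq_iff coord_space_def by (metis (mono_tags) mem_Collect_eq zero_index)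
qed

lemma exists_coord_space_preimage:
  assumes "w \<in> vec.span (\<Lambda> ` I)"
  shows "\<exists>c\<in>coord_space I. weight_sum \<Lambda> c = w"
proof -
  interpret Vector_Spaces.linear "(*s)" "(*s)" "weight_sum \<Lambda>"
    by (rule linear_weight_sum)
  have "axis i 1 \<in> (coord_space I :: (complex^_) set)" if "i \<in> I" for i
    using that by (auto simp: coord_space_def axis_def)
  then have "\<Lambda> ` I \<subseteq> weight_sum \<Lambda> ` coord_space I"
    using weight_sum_axis by (metis (no_types, lifting) image_iff image_subsetI)
  then have "vec.span (\<Lambda> ` I) \<subseteq> weight_sum \<Lambda> ` coord_space I"
    by (intro vec.span_minimal subspace_image subspace_coord_space)
  then show ?thesis
    using assms by blast
qed

text \<open>Justifies the definite description: the coefficients exist because the weight sum lies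
  in the span of the support weights, and independence makes them unique.\<close>

lemma resonance_coeff_works:
  assumes "inj_on \<Lambda> I" "vec.independent (\<Lambda> ` I)" and \<alpha>: "\<alpha> \<in> resonance_semigroup \<Lambda> I"
  shows "resonance_coeff \<Lambda> I (of_nat_vec \<alpha>) \<in> coord_space I"
    and "weight_sum \<Lambda> (resonance_coeff \<Lambda> I (of_nat_vec \<alpha>)) = weight_sum \<Lambda> (of_nat_vec \<alpha>)"
proof -
  interpret Vector_Spaces.linear "(*s)" "(*s)" "weight_sum \<Lambda>"
    by (rule linear_weight_sum)
  have ker: "of_nat_vec \<alpha> \<in> mu_kernel \<Lambda> I"
    by (rule of_nat_vec_in_mu_kernel[OF \<alpha>])
  let ?P = "\<lambda>c. c \<in> coord_space I \<and> weight_sum \<Lambda> c = weight_sum \<Lambda> (of_nat_vec \<alpha>)"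
  obtain c where c: "?P c"
    using exists_coord_space_preimage[of "weight_sum \<Lambda> (of_nat_vec \<alpha>)"] ker by (auto simp: mu_kernel_eq)
  have uniq: "c' = c" if "?P c'" for c'
  proof -
    have "c' - c \<in> coord_space I" "weight_sum \<Lambda> (c' - c) = 0"
      using that c by (simp_all add: coord_space_def diff)
    then have "c' - c = 0"
      by (rule weight_sum_eq_0_coord_space[OF assms(1,2)])
    then show ?thesis
      by simp
  qed
  have "resonance_coeff \<Lambda> I (of_nat_vec \<alpha>) = (THE c. ?P c)"
  proof -
    have "weight_sum \<Lambda> (of_nat_vec \<alpha>) = (\<Sum>j\<in>-I. of_int (of_nat_vec \<alpha> $ j) *s \<Lambda> j)"
      using ker by (subst weight_sum_coord_space[where A = "- I"])
        (simp_all add: mu_kernel_eq of_nat_vec_def)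
    then show ?thesis
      unfolding resonance_coeff_def
      by (intro arg_cong[where f = The]) (auto simp: fun_eq_iff weight_sum_coord_space)
  qed
  also have "?P \<dots>"
    by (rule theI[of ?P, OF c uniq])
  finally show "resonance_coeff \<Lambda> I (of_nat_vec \<alpha>) \<in> coord_space I"
    "weight_sum \<Lambda> (resonance_coeff \<Lambda> I (of_nat_vec \<alpha>)) = weight_sum \<Lambda> (of_nat_vec \<alpha>)"
    by auto
qed

text \<open>Testing the connection on the constant section X^\<alpha>, at the point with all support
  coordinates 1 and in direction e_i, isolates c_i(\<alpha>).\<close>

lemma log_connection_determines_coeff:
  fixes \<Lambda> \<Lambda>' :: "'n::finite \<Rightarrow> complex^'k::finite"
  assumes S: "resonance_semigroup \<Lambda> I = resonance_semigroup \<Lambda>' I"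
    and conn: "log_connection \<Lambda> I = log_connection \<Lambda>' I"
    and \<alpha>: "\<alpha> \<in> resonance_semigroup \<Lambda> I" and i: "i \<in> I"
  shows "resonance_coeff \<Lambda> I (of_nat_vec \<alpha>) $ i = resonance_coeff \<Lambda>' I (of_nat_vec \<alpha>) $ i"
proof -
  define s :: "complex^'n \<Rightarrow> (nat^'n) \<Rightarrow>\<^sub>0 complex"
    where "s = (\<lambda>z\<in>torus I. Poly_Mapping.single \<alpha> 1)"
  define z :: "complex^'n" where "z = (\<chi> j. if j \<in> I then 1 else 0)"
  define v :: "complex^'n" where "v = axis i 1"
  have z: "z \<in> torus I"
    by (auto simp: z_def torus_def coord_space_def)
  have v: "v \<in> coord_space I"
    using i by (auto simp: v_def coord_space_def axis_def)
  have "holomorphic_on_torus (\<lambda>z. Poly_Mapping.lookup (s z) \<beta>) (torus I)" for \<beta>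
    unfolding holomorphic_on_torus_def
  proof (intro ballI exI[of _ 0])
    fix w :: "complex^'n" assume "w \<in> torus I"
    have "scalar_product 0 = (\<lambda>_ :: complex^'n. 0 :: complex)"
      by (simp add: fun_eq_iff scalar_product_def)
    then have "((\<lambda>_. Poly_Mapping.lookup (Poly_Mapping.single \<alpha> 1) \<beta>) has_derivative scalar_product 0)
        (at w within torus I)"
      by simp
    then show "((\<lambda>z. Poly_Mapping.lookup (s z) \<beta>) has_derivative scalar_product 0) (at w within torus I)"
      by (rule has_derivative_transform[OF \<open>w \<in> torus I\<close>, rotated]) (simp add: s_def)
  qed
  moreover have "\<exists>V A. open V \<and> w \<in> V \<and> finite A \<and>
      (\<forall>u\<in>torus I \<inter> V. Poly_Mapping.keys (s u) \<subseteq> A)" for w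
    by (intro exI[of _ UNIV] exI[of _ "{\<alpha>}"]) (auto simp: s_def)
  ultimately have s: "s \<in> sections (resonance_semigroup \<Lambda> I) (torus I)"
    using \<alpha> by (auto simp: sections_def s_def semigroup_algebra_def)
  \<comment> \<open>Equal semigroups put \<open>(torus I, s)\<close> in the domain of both
    restricted maps.\<close>
  have eval: "log_connection M I (torus I, s) (z, v) = nabla M I s z v"
    if "resonance_semigroup M I = resonance_semigroup \<Lambda> I" for M :: "'n \<Rightarrow> complex^'k"
    using s z v that by (simp add: log_connection_def)
  \<comment> \<open>The \<open>ext_deriv\<close> term is the same for every configuration, so it
    cancels in the comparison without being evaluated.\<close>
  have lookup: "Poly_Mapping.lookup (nabla M I s z v) \<alpha> =
      Poly_Mapping.lookup (ext_deriv s z v) \<alpha> - resonance_coeff M I (of_nat_vec \<alpha>) $ i"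
    for M :: "'n \<Rightarrow> complex^'k"
  proof -
    have "Poly_Mapping.lookup (delta M I m (s z)) \<alpha> = resonance_coeff M I (of_nat_vec \<alpha>) $ m" for m
      using z by (simp add: delta_def s_def lookup_mapp)
    then have "Poly_Mapping.lookup (Poly_Mapping.map ((*) (v $ m / z $ m)) (delta M I m (s z))) \<alpha> =
        (if m = i then resonance_coeff M I (of_nat_vec \<alpha>) $ i else 0)" if "m \<in> I" for m
      using that by (auto simp: mult_map_scale_conv_mult lookup_scalar_mult v_def z_def axis_def)
    then show ?thesis
      using i by (simp add: nabla_def lookup_minus lookup_sum)
  qed
  show ?thesis
    using conn eval[of \<Lambda>] eval[of \<Lambda>'] S lookup[of \<Lambda>] lookup[of \<Lambda>'] by simp
qed

section \<open>Reconstruction of the weights\<close>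

text \<open>Off the support a relation is a combination of semigroup elements, which the same
  coefficients complete to relations of both configurations; independence of the support weights
  fixes the rest.\<close>

lemma weight_sum_kernel_subset:
  fixes \<Lambda> \<Lambda>' :: "'n::finite \<Rightarrow> complex^'k::finite"
  assumes "spanning \<Lambda>" "full_resonance_rank \<Lambda> I" "spanning \<Lambda>'" "full_resonance_rank \<Lambda>' I"
    and S: "resonance_semigroup \<Lambda> I = resonance_semigroup \<Lambda>' I"
    and conn: "log_connection \<Lambda> I = log_connection \<Lambda>' I"
    and v: "weight_sum \<Lambda> v = 0"
  shows "weight_sum \<Lambda>' v = 0"
proof -
  interpret F: Vector_Spaces.linear "(*s)" "(*s)" "weight_sum \<Lambda>"
    by (rule linear_weight_sum)
  interpret F': Vector_Spaces.linear "(*s)" "(*s)" "weight_sum \<Lambda>'"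
    by (rule linear_weight_sum)
  note indep = full_resonance_rank_imp(3,4)[OF assms(1,2)]
  note indep' = full_resonance_rank_imp(3,4)[OF assms(3,4)]
  let ?S = "resonance_semigroup \<Lambda> I"
  \<comment> \<open>Vectors that one and the same correction from C^I turns into relations of both
    configurations. As \<open>K\<close> is a subspace, generators suffice.\<close>
  define K where "K = {u. \<exists>c\<in>coord_space I. weight_sum \<Lambda> (u - c) = 0 \<and> weight_sum \<Lambda>' (u - c) = 0}"
  have "vec.subspace K"
  proof (rule vec.subspaceI)
    have "(0 :: complex^'n) \<in> coord_space I"
      by (rule vec.subspace_0[OF subspace_coord_space])
    then show "0 \<in> K"
      unfolding K_def by (intro CollectI bexI[of _ 0]) (simp_all add: F.zero F'.zero)
  next
    fix x y assume "x \<in> K" "y \<in> K"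
    then obtain c d where "c \<in> coord_space I" "d \<in> coord_space I"
      "weight_sum \<Lambda> (x - c) = 0" "weight_sum \<Lambda>' (x - c) = 0"
      "weight_sum \<Lambda> (y - d) = 0" "weight_sum \<Lambda>' (y - d) = 0"
      by (auto simp: K_def)
    then show "x + y \<in> K"
      unfolding K_def
      by (intro CollectI bexI[of _ "c + d"])
        (simp_all add: F.add F'.add F.diff F'.diff vec.subspace_add[OF subspace_coord_space])
  next
    fix a x assume "x \<in> K"
    then obtain c where "c \<in> coord_space I" "weight_sum \<Lambda> (x - c) = 0" "weight_sum \<Lambda>' (x - c) = 0"
      by (auto simp: K_def)
    then show "a *s x \<in> K"
      unfolding K_def
      by (intro CollectI bexI[of _ "a *s c"])
        (simp_all add: F.scale F'.scale F.diff F'.diff vec.subspace_scale[OF subspace_coord_space])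
  qed
  moreover have "of_nat_vec \<alpha> \<in> K" if \<alpha>: "\<alpha> \<in> ?S" for \<alpha>
  proof -
    define c where "c = resonance_coeff \<Lambda> I (of_nat_vec \<alpha>)"
    have c: "c \<in> coord_space I" "weight_sum \<Lambda> c = weight_sum \<Lambda> (of_nat_vec \<alpha>)"
      using resonance_coeff_works[OF indep \<alpha>] by (simp_all add: c_def)
    have c': "resonance_coeff \<Lambda>' I (of_nat_vec \<alpha>) \<in> coord_space I"
      "weight_sum \<Lambda>' (resonance_coeff \<Lambda>' I (of_nat_vec \<alpha>)) = weight_sum \<Lambda>' (of_nat_vec \<alpha>)"
      using resonance_coeff_works[OF indep'] \<alpha> S by simp_all
    have "c $ i = resonance_coeff \<Lambda>' I (of_nat_vec \<alpha>) $ i" for i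
      using log_connection_determines_coeff[OF S conn \<alpha>, of i] c(1) c'(1)
      by (cases "i \<in> I") (auto simp: c_def coord_space_def)
    then have "c = resonance_coeff \<Lambda>' I (of_nat_vec \<alpha>)"
      by (simp add: vec_eq_iff)
    then show ?thesis
      unfolding K_def using c c' by (intro CollectI bexI[of _ c]) (simp_all add: F.diff F'.diff)
  qed
  ultimately have "vec.span (of_nat_vec ` ?S) \<subseteq> K"
    by (intro vec.span_minimal) auto
  \<comment> \<open>Full resonance rank makes the semigroup span the whole kernel of mu_I.\<close>
  then have K: "mu_kernel \<Lambda> I \<subseteq> K"
    using full_resonance_rank_imp(2)[OF assms(1,2)] complexification_resonance_lattice by metis
  define p :: "complex^'n" where "p = (\<chi> j. if j \<in> I then v $ j else 0)"
  have p: "p \<in> coord_space I" "v - p \<in> coord_space (- I)"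
    by (auto simp: p_def coord_space_def)
  have "weight_sum \<Lambda> (v - p) \<in> vec.span (\<Lambda> ` I)"
    using v by (simp add: F.diff vec.span_neg weight_sum_coord_space_in_span[OF p(1)])
  then obtain c where c: "c \<in> coord_space I"
    "weight_sum \<Lambda> (v - p - c) = 0" "weight_sum \<Lambda>' (v - p - c) = 0"
    using K p(2) by (auto simp: K_def mu_kernel_eq)
  \<comment> \<open>\<open>p + c\<close> is a relation among independent support weights, so it is 0
    and \<open>v - p - c\<close> is \<open>v\<close> itself.\<close>
  have "weight_sum \<Lambda> (p + c) = weight_sum \<Lambda> v - weight_sum \<Lambda> (v - p - c)"
    by (simp add: F.diff F.add)
  then have "weight_sum \<Lambda> (p + c) = 0"
    using c(2) v by simp
  then have "p + c = 0"
    by (rule weight_sum_eq_0_coord_space[OF indep vec.subspace_add[OF subspace_coord_space p(1) c(1)]])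
  then show ?thesis
    using c(3) by (simp add: diff_diff_eq)
qed

text \<open>A linear section of one weight map followed by the other weight map gives
  \<open>\<phi>\<close>; the kernel inclusion makes it compatible with both. A surjective
  endomorphism in finite dimension is bijective, so one inclusion suffices.\<close>

lemma exists_linear_equivalence:
  fixes \<Lambda> \<Lambda>' :: "'n::finite \<Rightarrow> complex^'k::finite"
  assumes "spanning \<Lambda>" "spanning \<Lambda>'"
    and ker: "\<And>v. weight_sum \<Lambda> v = 0 \<Longrightarrow> weight_sum \<Lambda>' v = 0"
  shows "\<exists>\<phi>. Vector_Spaces.linear (*s) (*s) \<phi> \<and> bij \<phi> \<and> (\<forall>j. \<phi> (\<Lambda> j) = \<Lambda>' j)"
proof -
  interpret F: Vector_Spaces.linear "(*s)" "(*s)" "weight_sum \<Lambda>"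
    by (rule linear_weight_sum)
  interpret F': Vector_Spaces.linear "(*s)" "(*s)" "weight_sum \<Lambda>'"
    by (rule linear_weight_sum)
  obtain g where g: "Vector_Spaces.linear (*s) (*s) g" "\<And>y. weight_sum \<Lambda> (g y) = y"
    using vec.linear_surjective_right_inverse[OF linear_weight_sum surj_weight_sum[OF assms(1)]]
    by (auto simp: fun_eq_iff)
  define \<phi> where "\<phi> = weight_sum \<Lambda>' \<circ> g"
  have lin: "Vector_Spaces.linear (*s) (*s) \<phi>"
    unfolding \<phi>_def by (rule Vector_Spaces.linear_compose[OF g(1) linear_weight_sum])
  have \<phi>: "\<phi> (weight_sum \<Lambda> v) = weight_sum \<Lambda>' v" for v
    using ker[of "g (weight_sum \<Lambda> v) - v"] by (simp add: \<phi>_def F.diff F'.diff g(2))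
  then have "surj \<phi>"
    using surj_weight_sum[OF assms(2)] by (metis surj_def)
  then have "bij \<phi>"
    using vec.linear_surj_imp_inj[OF lin] by (simp add: bij_def)
  moreover have "\<phi> (\<Lambda> j) = \<Lambda>' j" for j
    using \<phi>[of "axis j 1"] by simp
  ultimately show ?thesis
    using lin by blast
qed

text \<open>Independence of the labelled family is injectivity on \<open>I\<close> together with
  independence of the set of weights.\<close>

theorem theoremD:
  fixes \<Lambda> :: "'n::finite \<Rightarrow> complex^'k::finite" and I :: "'n set"
  assumes "spanning \<Lambda>"
    and "I \<noteq> {}"
    and "singular_support \<Lambda> I"
    and "full_resonance_rank \<Lambda> I"
  shows "support_rank \<Lambda> I = card I \<and>
    complexification (resonance_lattice \<Lambda> I) = mu_kernel \<Lambda> I \<and>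
    (inj_on \<Lambda> I \<and> vec.independent (\<Lambda> ` I)) \<and>
    (\<forall>\<Lambda>' :: 'n \<Rightarrow> complex^'k.
      spanning \<Lambda>' \<and> singular_support \<Lambda>' I \<and> full_resonance_rank \<Lambda>' I \<and>
      resonance_semigroup \<Lambda> I = resonance_semigroup \<Lambda>' I \<and>
      log_connection \<Lambda> I = log_connection \<Lambda>' I \<longrightarrow>
      (\<exists>\<phi>. Vector_Spaces.linear (*s) (*s) \<phi> \<and> bij \<phi> \<and> (\<forall>j. \<phi> (\<Lambda> j) = \<Lambda>' j)))"
proof (intro conjI allI impI)
  fix \<Lambda>' :: "'n \<Rightarrow> complex^'k"
  assume "spanning \<Lambda>' \<and> singular_support \<Lambda>' I \<and> full_resonance_rank \<Lambda>' I \<and>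
    resonance_semigroup \<Lambda> I = resonance_semigroup \<Lambda>' I \<and> log_connection \<Lambda> I = log_connection \<Lambda>' I"
  then show "\<exists>\<phi>. Vector_Spaces.linear (*s) (*s) \<phi> \<and> bij \<phi> \<and> (\<forall>j. \<phi> (\<Lambda> j) = \<Lambda>' j)"
    using assms by (intro exists_linear_equivalence weight_sum_kernel_subset[of \<Lambda> I \<Lambda>']) auto
qed (use full_resonance_rank_imp[OF assms(1,4)] in auto)

end
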